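(* Let $\mathbb{A}$ be a finite non-empty set. For every aperiodic word $x\in\mathbb{A}^{\mathbb{N}}$, the shift orbit closure of $x$ contains a point $y$ which is not self-shuffling.
   Context: An infinite word is aperiodic if it is not ultimately periodic. The shift orbit closure of $x$ is the set of infinite words all of whose finite factors are factors of $x$. A word $y\in\mathbb{A}^{\mathbb{N}}$ is self-shuffling if there exist finite (possibly empty) words $U_i,V_i\in\mathbb{A}^*$ ($i\ge 0$) with $y=\prod_{i=0}^\infty U_iV_i=\prod_{i=0}^\infty U_i=\prod_{i=0}^\infty V_i$. *)

theory Defs
  imports "HOL-Library.Omega_Words_Fun"
begin

definition ultimately_periodic :: "'a word \<Rightarrow> bool" where
  "ultimately_periodic x \<longleftrightarrow> (\<exists>u v. v \<noteq> [] \<and> x = u \<frown> v\<^sup>\<omega>)"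

definition aperiodic :: "'a word \<Rightarrow> bool" where
  "aperiodic x \<longleftrightarrow> \<not> ultimately_periodic x"

definition word_factors :: "'a word \<Rightarrow> 'a list set" where
  "word_factors x = {w. \<exists>u z. x = u \<frown> w \<frown> z}"

text \<open>Every letter of a word is a factor of it, so if \<open>x\<close> is a word over an alphabet,
  then the members of its shift orbit closure are words over the same alphabet.\<close>
definition shift_orbit_closure :: "'a word \<Rightarrow> 'a word set" where
  "shift_orbit_closure x = {y. word_factors y \<subseteq> word_factors x}"

text \<open>\<open>is_infinite_product W y\<close> says that \<open>y\<close> is the infinite word \<open>W 0 W 1 W 2 \<dots>\<close>.
  It is a relation because the product is a finite word, and hence equal to no infinite word,
  if only finitely many of the \<open>W i\<close> are non-empty; the second conjunct excludes this.\<close>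
definition is_infinite_product :: "(nat \<Rightarrow> 'a list) \<Rightarrow> 'a word \<Rightarrow> bool" where
  "is_infinite_product W y \<longleftrightarrow>
     (\<forall>n. \<exists>z. y = concat (map W [0..<n]) \<frown> z) \<and>
     (\<forall>k. \<exists>n. k \<le> length (concat (map W [0..<n])))"

text \<open>The \<open>U i\<close> and \<open>V i\<close> consist of letters of \<open>y\<close>, so the alphabet need not be mentioned.\<close>
definition self_shuffling :: "'a word \<Rightarrow> bool" where
  "self_shuffling y \<longleftrightarrow>
     (\<exists>U V. is_infinite_product (\<lambda>i. U i @ V i) y \<and>
            is_infinite_product U y \<and> is_infinite_product V y)"

end

theory Submission
  imports Defs "HOL-Library.List_Lexorder"
begin

text \<open>Two kinds of words are never self-shuffling, and the shift orbit closure of an aperiodic word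
  \<open>x\<close> over a finite alphabet always contains a word of one of them.

  The first kind are the words \<open>c q\<^sup>\<omega>\<close> in which the letter \<open>c\<close> is not the last letter of \<open>q\<close>
  (\<open>broken_period_not_self_shuffling\<close>). If such a word \<open>y\<close> is a shuffle of itself with itself, then its
  prefix of length \<open>i + j\<close> contains as many letters \<open>c\<close> as its prefixes of lengths \<open>i\<close> and \<open>j\<close>
  together, whenever \<open>i\<close> letters of the first copy and \<open>j\<close> of the second have been consumed.
  When \<open>i\<close> is a multiple of \<open>\<bar>q\<bar>\<close> and \<open>j > 0\<close>, the last \<open>i\<close> letters of the prefix of length \<open>i + j\<close>
  form a conjugate of a power of \<open>q\<close>, whereas the prefix of length \<open>i\<close> is a conjugate of the same
  power with a \<open>c\<close> in place of the last letter of one \<open>q\<close>. The two counts therefore differ by one.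

  The second kind are the infinite Lyndon words, those strictly below all their proper suffixes
  in the lexicographic order (\<open>infinite_lyndon_not_self_shuffling\<close>). Every shuffle of such a
  word \<open>y\<close> with itself that uses both copies is strictly below \<open>y\<close>. Indeed, by an exchange
  argument (\<open>shuffle_exchange\<close>) a shuffle does not become smaller when
  letters are taken from the lexicographically larger of the two remaining words first, and this
  is always the copy that is already in use, because its remainder is a proper suffix of \<open>y\<close> as
  long as the other copy is untouched.

  If for some \<open>P > 0\<close> the word \<open>x\<close> has arbitrarily long factors of period \<open>P\<close>, then, \<open>x\<close> itself not
  being periodic, some of these can be extended to the left until the period breaks, and a limit of
  the extended factors is of the first kind (\<open>ex_broken_period_limit\<close>). Otherwise the closure contains
  no periodic word, and its least element (\<open>ex_least_limit\<close>) is below each of its proper suffixes,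
  which lie in the closure too, and different from them: it is of the second kind.\<close>

section \<open>Factors and the shift orbit closure\<close>

lemma word_factors_iff: "w \<in> word_factors x \<longleftrightarrow> (\<exists>s. \<forall>k<length w. w ! k = x (s + k))"
proof
  assume "w \<in> word_factors x"
  then obtain u z where "x = u \<frown> w \<frown> z" unfolding word_factors_def by auto
  then have "\<forall>k<length w. w ! k = x (length u + k)" by (simp add: conc_def)
  then show "\<exists>s. \<forall>k<length w. w ! k = x (s + k)" ..
next
  assume "\<exists>s. \<forall>k<length w. w ! k = x (s + k)"
  then obtain s where s: "\<forall>k<length w. w ! k = x (s + k)" ..
  have "prefix (length w) (suffix s x) = w"
    by (rule nth_equalityI) (simp_all add: s)
  then have "x = prefix s x \<frown> w \<frown> suffix (length w) (suffix s x)"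
    by (metis prefix_suffix)
  then show "w \<in> word_factors x" unfolding word_factors_def by blast
qed

lemma shift_orbit_closureI:
  assumes "\<And>n. \<exists>s. \<forall>k<n. y k = x (s + k)"
  shows "y \<in> shift_orbit_closure x"
proof -
  have "w \<in> word_factors x" if "w \<in> word_factors y" for w
  proof -
    from that obtain r where r: "\<forall>k<length w. w ! k = y (r + k)" by (auto simp: word_factors_iff)
    obtain s where s: "\<forall>k<r + length w. y k = x (s + k)" using assms by blast
    have "\<forall>k<length w. w ! k = x ((s + r) + k)" using r s by (simp add: add.assoc)
    then show ?thesis unfolding word_factors_iff by blast
  qed
  then show ?thesis by (auto simp: shift_orbit_closure_def)
qed

section \<open>Self-shuffling words as lattice paths\<close>

text \<open>The number \<open>u t\<close> counts the letters that the first copy of \<open>y\<close> has contributed to the first \<open>t\<close>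
  letters of the shuffle; the second copy has contributed the other \<open>t - u t\<close>. Unlike the blocks
  \<open>U i\<close> and \<open>V i\<close>, which may be empty, this description moves by exactly one letter at a time.\<close>
definition shuffle_path :: "'a word \<Rightarrow> (nat \<Rightarrow> nat) \<Rightarrow> bool" where
  "shuffle_path y u \<longleftrightarrow> u 0 = 0 \<and>
     (\<forall>t. u (Suc t) = Suc (u t) \<and> y t = y (u t) \<or> u (Suc t) = u t \<and> y t = y (t - u t)) \<and>
     (\<forall>m. \<exists>t. m \<le> u t) \<and> (\<forall>m. \<exists>t. m \<le> t - u t)"

lemma infinite_product_nth:
  assumes "is_infinite_product W y" "k < length (W n)"
  shows "y (length (concat (map W [0..<n])) + k) = W n ! k"
proof -
  obtain z where "y = concat (map W [0..<Suc n]) \<frown> z"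
    using assms(1) unfolding is_infinite_product_def by blast
  then show ?thesis using assms(2) by (simp add: conc_def nth_append)
qed

lemma self_shuffling_imp_path:
  assumes "self_shuffling y"
  obtains u where "shuffle_path y u"
proof -
  obtain U V where UV: "is_infinite_product (\<lambda>i. U i @ V i) y"
    and U: "is_infinite_product U y" and V: "is_infinite_product V y"
    using assms unfolding self_shuffling_def by blast
  define a where "a n = length (concat (map U [0..<n]))" for n
  define b where "b n = length (concat (map V [0..<n]))" for n
  have ab: "length (concat (map (\<lambda>i. U i @ V i) [0..<n])) = a n + b n" for n
    by (induction n) (simp_all add: a_def b_def)
  have a0: "a 0 = 0" "b 0 = 0" and aS: "a (Suc n) = a n + length (U n)"
    and bS: "b (Suc n) = b n + length (V n)" for n
    by (simp_all add: a_def b_def)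
  have a_unb: "\<exists>n. m \<le> a n" and b_unb: "\<exists>n. m \<le> b n" for m
    using U V unfolding is_infinite_product_def a_def b_def by blast+
  have a_mono: "a m \<le> a n" and b_mono: "b m \<le> b n" if "m \<le> n" for m n
    using that by (rule lift_Suc_mono_le[rotated]; simp add: aS bS)+
  have yU: "y (i + b n) = y i" if lo: "a n \<le> i" and hi: "i < a (Suc n)" for n i
  proof -
    obtain k where k: "i = a n + k" using lo by (auto simp: le_iff_add)
    then have "k < length (U n)" using hi by (simp add: aS)
    then show ?thesis
      using infinite_product_nth[OF U, of k n] infinite_product_nth[OF UV, of k n]
      unfolding ab by (simp add: k a_def nth_append ac_simps)
  qed
  have yV: "y (a (Suc n) + j) = y j" if lo: "b n \<le> j" and hi: "j < b (Suc n)" for n j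
  proof -
    obtain k where k: "j = b n + k" using lo by (auto simp: le_iff_add)
    then have "k < length (V n)" using hi by (simp add: bS)
    then show ?thesis
      using infinite_product_nth[OF V, of k n] infinite_product_nth[OF UV, of "length (U n) + k" n]
      unfolding ab by (simp add: k b_def aS nth_append ac_simps)
  qed
  \<comment> \<open>The index of the pair of blocks \<open>U n\<close>, \<open>V n\<close> that contains the position \<open>t\<close>. Within it the
    path first follows \<open>U n\<close>, so that \<open>u\<close> grows, and stays at \<open>a (Suc n)\<close> from then on.\<close>
  define blk where "blk t = (LEAST n. t < a (Suc n) + b (Suc n))" for t
  define u where "u t = min (t - b (blk t)) (a (Suc (blk t)))" for t
  have blk_hi: "t < a (Suc (blk t)) + b (Suc (blk t))" for t
  proof -
    obtain n where "Suc t \<le> a n" using a_unb by blast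
    also have "a n \<le> a (Suc n)" by (rule a_mono) simp
    finally have "t < a (Suc n) + b (Suc n)" by simp
    then show ?thesis unfolding blk_def by (rule LeastI)
  qed
  have blk_lo: "a (blk t) + b (blk t) \<le> t" for t
  proof (cases "blk t")
    case 0 then show ?thesis by (simp add: a0)
  next
    case (Suc m)
    then have "\<not> t < a (Suc m) + b (Suc m)"
      unfolding blk_def by (metis lessI not_less_Least)
    then show ?thesis using Suc by simp
  qed
  \<comment> \<open>At an end point of a pair of blocks, the formulas of all adjacent pairs agree, so the step from
    one pair to the next needs no separate treatment.\<close>
  have u_eq: "u t = min (t - b n) (a (Suc n))"
    if "a n + b n \<le> t" "t \<le> a (Suc n) + b (Suc n)" for t n
  proof -
    consider "blk t = n" | "blk t < n" | "n < blk t" by linarith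
    then show ?thesis
    proof cases
      case 2
      then have "a (Suc (blk t)) \<le> a n" "b (Suc (blk t)) \<le> b n" by (simp_all add: a_mono b_mono)
      then show ?thesis using that blk_hi[of t] by linarith
    next
      case 3
      then have le: "a (Suc n) \<le> a (blk t)" "b (Suc n) \<le> b (blk t)" by (simp_all add: a_mono b_mono)
      have "b n \<le> b (Suc n)" "a (blk t) \<le> a (Suc (blk t))" by (simp_all add: a_mono b_mono)
      then show ?thesis unfolding u_def using le that blk_lo[of t] by linarith
    qed (simp add: u_def)
  qed
  have step: "u (Suc t) = Suc (u t) \<and> y t = y (u t) \<or> u (Suc t) = u t \<and> y t = y (t - u t)" for t
  proof -
    define n where "n = blk t"
    have lo: "a n + b n \<le> t" and hi: "t < a (Suc n) + b (Suc n)"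
      using blk_lo blk_hi by (auto simp: n_def)
    have ut: "u t = min (t - b n) (a (Suc n))" and uSt: "u (Suc t) = min (Suc t - b n) (a (Suc n))"
      using u_eq[of n t] u_eq[of n "Suc t"] lo hi by auto
    show ?thesis
    proof (cases "t - b n < a (Suc n)")
      case True
      then have "y t = y (t - b n)" using yU[of n "t - b n"] lo by simp
      then show ?thesis using True ut uSt lo by auto
    next
      case False
      have "b n \<le> t - a (Suc n)" "t - a (Suc n) < b (Suc n)" using False lo hi by auto
      then have "y t = y (t - a (Suc n))" using yV[of n "t - a (Suc n)"] False lo hi by simp
      then show ?thesis using False ut uSt lo by auto
    qed
  qed
  have u_ab: "u (a n + b n) = a n" for n
    using u_eq[of n "a n + b n"] a_mono[of n "Suc n"] b_mono[of n "Suc n"] by simp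
  have "shuffle_path y u"
    unfolding shuffle_path_def
  proof (intro conjI allI)
    show "u 0 = 0" using u_ab[of 0] by (simp add: a0)
    show "\<exists>t. m \<le> u t" for m using a_unb[of m] u_ab by metis
    show "\<exists>t. m \<le> t - u t" for m using b_unb[of m] u_ab by (metis diff_add_inverse)
  qed (rule step)
  then show thesis by (rule that)
qed

lemma shuffle_path_le: "shuffle_path y u \<Longrightarrow> u t \<le> t"
proof (induction t)
  case (Suc t)
  then show ?case unfolding shuffle_path_def by (metis Suc_le_mono le_SucI)
qed (simp add: shuffle_path_def)

lemma shuffle_path_swap:
  assumes "shuffle_path y u"
  shows "shuffle_path y (\<lambda>t. t - u t)"
proof -
  have le: "u t \<le> t" for t using shuffle_path_le[OF assms] .
  then have minus: "t - (t - u t) = u t" for t by simp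
  have "Suc t - u (Suc t) = Suc (t - u t) \<and> y t = y (t - u t) \<or>
      Suc t - u (Suc t) = t - u t \<and> y t = y (t - (t - u t))" for t
  proof -
    consider "u (Suc t) = Suc (u t)" "y t = y (u t)" | "u (Suc t) = u t" "y t = y (t - u t)"
      using assms unfolding shuffle_path_def by blast
    then show ?thesis using le[of t] by cases (simp_all add: Suc_diff_le)
  qed
  moreover have "\<exists>t. m \<le> u t" "\<exists>t. m \<le> t - u t" for m
    using assms unfolding shuffle_path_def by blast+
  ultimately show ?thesis unfolding shuffle_path_def minus by simp
qed

text \<open>Letters can thus be coded by numbers, which makes a lexicographic order available.\<close>
lemma self_shuffling_comp:
  assumes "self_shuffling y"
  shows "self_shuffling (f \<circ> y)"
proof -
  have prod: "is_infinite_product (\<lambda>i. map f (W i)) (f \<circ> y)" if "is_infinite_product W y" for W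
  proof -
    have "concat (map (\<lambda>i. map f (W i)) [0..<n]) = map f (concat (map W [0..<n]))" for n
      by (simp add: map_concat comp_def)
    moreover have "f \<circ> (v \<frown> z) = map f v \<frown> (f \<circ> z)" for v z
      by (auto simp: conc_def fun_eq_iff)
    ultimately show ?thesis
      using that unfolding is_infinite_product_def by (metis length_map)
  qed
  obtain U V where "is_infinite_product (\<lambda>i. U i @ V i) y" "is_infinite_product U y" "is_infinite_product V y"
    using assms unfolding self_shuffling_def by blast
  then show ?thesis
    unfolding self_shuffling_def using prod[of U] prod[of V] prod[of "\<lambda>i. U i @ V i"]
    by (intro exI[of _ "\<lambda>i. map f (U i)"] exI[of _ "\<lambda>i. map f (V i)"]) simp
qed

section \<open>Words with a broken period\<close>

text \<open>The words \<open>c q\<^sup>\<omega>\<close> of the introduction, with \<open>P = \<bar>q\<bar>\<close>, \<open>c = y 0\<close> and \<open>y P\<close> the last letter of \<open>q\<close>.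
  The contradiction comes from counting the letter \<open>y 0\<close> along the path.\<close>
lemma broken_period_not_self_shuffling:
  assumes P: "0 < P" and period: "\<And>t. 0 < t \<Longrightarrow> y (t + P) = y t" and break: "y P \<noteq> y 0"
  shows "\<not> self_shuffling y"
proof
  assume "self_shuffling y"
  then obtain u where u: "shuffle_path y u" by (rule self_shuffling_imp_path)
  have u0: "u 0 = 0"
    and step: "\<And>t. u (Suc t) = Suc (u t) \<and> y t = y (u t) \<or> u (Suc t) = u t \<and> y t = y (t - u t)"
    and u_unb: "\<And>m. \<exists>t. m \<le> u t" and v_unb: "\<And>m. \<exists>t. m \<le> t - u t"
    using u unfolding shuffle_path_def by blast+
  have le: "u t \<le> t" for t using shuffle_path_le[OF u] .
  define C where "C n = (\<Sum>k<n. of_bool (y k = y 0) :: nat)" for n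
  have CS: "C (Suc n) = C n + of_bool (y n = y 0)" for n by (simp add: C_def)
  have additive: "C t = C (u t) + C (t - u t)" for t
  proof (induction t)
    case (Suc t)
    show ?case using step[of t] Suc le[of t] by (auto simp: CS Suc_diff_le)
  qed (simp add: u0 C_def)
  have u_mono: "u s \<le> u t" if "s \<le> t" for s t
    using that by (rule lift_Suc_mono_le[rotated]) (metis step le_SucI order_refl)
  have v_mono: "s - u s \<le> t - u t" if "s \<le> t" for s t
    using that by (rule lift_Suc_mono_le[rotated, where f = "\<lambda>t. t - u t"])
      (metis step le Suc_diff_le diff_Suc_Suc le_SucI order_refl)
  obtain t0 where t0: "1 \<le> t0 - u t0" using v_unb by blast
  \<comment> \<open>A multiple of the period so large that the path reaches \<open>u t = Q\<close> only after the second copy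
    has come into use.\<close>
  define Q where "Q = P * Suc (u t0)"
  have "Suc (u t0) \<le> Q" unfolding Q_def using P by (cases P) simp_all
  have period_mult: "y (t + P * m) = y t" if "0 < t" for t m
  proof (induction m)
    case (Suc m)
    have "y (t + P * Suc m) = y ((t + P * m) + P)" by (simp add: algebra_simps)
    then show ?case using period[of "t + P * m"] that Suc by simp
  qed simp
  have "y Q = y P" using period_mult[of P "u t0"] P by (simp add: Q_def)
  then have CQ: "C (Suc Q) = C Q" using break by (simp add: CS)
  \<comment> \<open>All windows of length \<open>Q\<close> that start after position \<open>0\<close> contain equally many letters \<open>y 0\<close>,
    namely one less than the prefix of length \<open>Q\<close>.\<close>
  have shift: "C (Suc j + Q) + 1 = C (Suc j) + C (Suc Q)" for j
  proof (induction j)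
    case 0 then show ?case by (simp add: CS) (simp add: C_def)
  next
    case (Suc j)
    have "y (Suc j + Q) = y (Suc j)" unfolding Q_def by (rule period_mult) simp
    then show ?case using Suc CS[of "Suc j + Q"] CS[of "Suc j"] by simp
  qed
  define t where "t = (LEAST t. Q \<le> u t)"
  have "Q \<le> u t" unfolding t_def using u_unb by (rule LeastI_ex)
  moreover have "t \<noteq> 0" using \<open>Q \<le> u t\<close> \<open>Suc (u t0) \<le> Q\<close> u0 by (cases t) auto
  then obtain s where s: "t = Suc s" by (cases t) auto
  then have "\<not> Q \<le> u s" using not_less_Least[of s "\<lambda>t. Q \<le> u t"] by (simp add: t_def)
  ultimately have ut: "u t = Q" using step[of s] s by auto
  have "t0 \<le> t"
  proof (rule ccontr)
    assume "\<not> t0 \<le> t"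
    then have "u t \<le> u t0" by (intro u_mono) simp
    then show False using ut \<open>Suc (u t0) \<le> Q\<close> by simp
  qed
  then have "1 \<le> t - u t" using v_mono[of t0 t] t0 by simp
  then obtain j where j: "t - u t = Suc j" by (cases "t - u t") auto
  then have "t = Suc j + Q" using ut le[of t] by simp
  then show False using additive[of t] j ut shift[of j] CQ by simp
qed

section \<open>The exchange argument\<close>

text \<open>The lexicographic order on infinite words, in a form that refers to the first difference only
  implicitly.\<close>
definition lex_le :: "'a::linorder word \<Rightarrow> 'a word \<Rightarrow> bool" where
  "lex_le S T \<longleftrightarrow> (\<forall>n. (\<forall>k<n. S k = T k) \<longrightarrow> S n \<le> T n)"

text \<open>The finite word is a prefix of some shuffle of the two infinite words; how many of its letters
  come from each of them is left open.\<close>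
fun shuffle_prefix :: "'a list \<Rightarrow> 'a word \<Rightarrow> 'a word \<Rightarrow> bool" where
  "shuffle_prefix [] S T \<longleftrightarrow> True"
| "shuffle_prefix (c # w) S T \<longleftrightarrow>
     S 0 = c \<and> shuffle_prefix w (suffix 1 S) T \<or> T 0 = c \<and> shuffle_prefix w S (suffix 1 T)"

lemma shuffle_prefix_exists: "\<exists>w. length w = n \<and> shuffle_prefix w S T"
proof (induction n arbitrary: S)
  case (Suc n)
  then obtain w where "length w = n" "shuffle_prefix w (suffix 1 S) T" by blast
  then have "length (S 0 # w) = Suc n \<and> shuffle_prefix (S 0 # w) S T" by simp
  then show ?case by blast
qed simp

lemma lex_le_suffix:
  assumes "lex_le S T" "\<And>k. k < n \<Longrightarrow> S k = T k"
  shows "lex_le (suffix n S) (suffix n T)"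
  unfolding lex_le_def
proof (intro allI impI)
  fix m assume *: "\<forall>k<m. suffix n S k = suffix n T k"
  have "S k = T k" if "k < n + m" for k
    using assms(2)[of k] *[rule_format, of "k - n"] that by (cases "k < n") auto
  then show "suffix n S m \<le> suffix n T m" using assms(1) by (simp add: lex_le_def)
qed

lemma conc_Cons_0: "((b # p) \<frown> S) 0 = b" and suffix_1_conc_Cons: "suffix 1 ((b # p) \<frown> S) = p \<frown> S"
  by (auto simp: conc_def fun_eq_iff)

lemma conc_split_head: "p \<frown> S = (p @ [S 0]) \<frown> suffix 1 S"
proof -
  have "[S 0] \<frown> suffix 1 S = S" by (auto simp: conc_def fun_eq_iff)
  then show ?thesis by (metis conc_conc)
qed

text \<open>Let \<open>T\<close> be at most \<open>S\<close>. In a shuffle of \<open>p S\<close> and \<open>T\<close>, take the letters of \<open>p\<close> at the same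
  times but from \<open>p T\<close>, and replace the letters taken from \<open>T\<close> by those of \<open>S\<close>. The first
  replacement that changes a letter increases it, and the rest is then arbitrary. While nothing has
  changed, \<open>S\<close> and \<open>T\<close> have lost a common prefix, and appending it to what remains of \<open>p\<close>
  restores the form of the claim; this is why \<open>p\<close> has to be arbitrary in the induction. Once \<open>p\<close>
  is empty, both sides shuffle the same two words.\<close>
lemma shuffle_exchange:
  fixes S T :: "'a::linorder word"
  assumes "shuffle_prefix w (p \<frown> S) T" "lex_le T S"
  shows "\<exists>w'. shuffle_prefix w' S (p \<frown> T) \<and> length w' = length w \<and> w \<le> w'"
  using assms
proof (induction w arbitrary: p S T)
  case Nil then show ?case by simp
next
  case (Cons c w)
  show ?case
  proof (cases p)
    case Nil
    then show ?thesis using Cons.prems(1) by (intro exI[of _ "c # w"]) simp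
  next
    case (Cons b q)
    consider "b = c" "shuffle_prefix w (q \<frown> S) T" | "T 0 = c" "shuffle_prefix w (p \<frown> S) (suffix 1 T)"
      using Cons.prems(1) unfolding Cons by (auto simp only: shuffle_prefix.simps conc_Cons_0 suffix_1_conc_Cons)
    then show ?thesis
    proof cases
      case 1
      obtain w' where "shuffle_prefix w' S (q \<frown> T)" "length w' = length w" "w \<le> w'"
        using Cons.IH[OF 1(2) Cons.prems(2)] by blast
      then have "shuffle_prefix (c # w') S (p \<frown> T) \<and> length (c # w') = length (c # w) \<and> c # w \<le> c # w'"
        using 1 unfolding Cons by (simp only: shuffle_prefix.simps conc_Cons_0 suffix_1_conc_Cons) simp
      then show ?thesis by blast
    next
      case 2
      have "c \<le> S 0" using Cons.prems(2) 2(1) unfolding lex_le_def by auto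
      then consider "c < S 0" | "S 0 = c" by fastforce
      then show ?thesis
      proof cases
        case 1
        obtain w' where "shuffle_prefix w' (suffix 1 S) (p \<frown> T)" "length w' = length w"
          using shuffle_prefix_exists by blast
        then have "shuffle_prefix (S 0 # w') S (p \<frown> T) \<and> length (S 0 # w') = length (c # w) \<and> c # w \<le> S 0 # w'"
          using 1 by simp
        then show ?thesis by blast
      next
        case eq: 2
        have "shuffle_prefix w ((p @ [c]) \<frown> suffix 1 S) (suffix 1 T)"
          using 2(2) conc_split_head[of p S] eq by simp
        moreover have "lex_le (suffix 1 T) (suffix 1 S)"
          by (rule lex_le_suffix[OF Cons.prems(2)]) (simp add: 2 eq)
        ultimately obtain w' where "shuffle_prefix w' (suffix 1 S) ((p @ [c]) \<frown> suffix 1 T)"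
          "length w' = length w" "w \<le> w'" using Cons.IH by blast
        then have "shuffle_prefix (c # w') S (p \<frown> T) \<and> length (c # w') = length (c # w) \<and> c # w \<le> c # w'"
          using eq conc_split_head[of p T] 2(1) by simp
        then show ?thesis by blast
      qed
    qed
  qed
qed

section \<open>Infinite Lyndon words\<close>

text \<open>The shuffle has reached the point where \<open>i\<close> letters of the first copy and \<open>k\<close> of the second are
  used up, and the second copy was entered only after the \<open>i\<close> letters of the first, so that these
  \<open>k\<close> letters agree with \<open>y\<close> from position \<open>i\<close> on. If the next letter comes from the second copy,
  it is smaller than the one of \<open>y\<close>, or equal to it and \<open>k\<close> grows. If it comes from the first copy,
  \<open>shuffle_exchange\<close> bounds the shuffle by one in which the first copy has contributed the \<open>k\<close>
  letters instead and the second copy starts afresh, that is, by the situation with \<open>i + k\<close> and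
  \<open>1\<close>. The sum \<open>i + k\<close> grows in either case. If it reached \<open>N\<close> without a difference, then the
  prefix of length \<open>N\<close> would have a border starting at \<open>i\<close>; excluding this makes the inequality
  strict.\<close>
lemma shuffle_less_of_least:
  fixes y :: "'a::linorder word"
  assumes least: "\<And>i. lex_le y (suffix i y)"
    and unbordered: "\<And>i. i0 \<le> i \<Longrightarrow> i < N \<Longrightarrow> \<exists>k. i + k < N \<and> y (i + k) \<noteq> y k"
  shows "i0 \<le> i \<Longrightarrow> 0 < k \<Longrightarrow> (\<And>l. l < k \<Longrightarrow> y (i + l) = y l) \<Longrightarrow> i + k + length w = N \<Longrightarrow>
    shuffle_prefix w (suffix i y) (suffix k y) \<Longrightarrow> w < map y [i + k..<N]"
proof (induction "length w" arbitrary: w i k)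
  case 0
  then have "i < N" by simp
  then obtain l where "i + l < N" "y (i + l) \<noteq> y l" using unbordered 0 by blast
  then show ?case using 0 by auto
next
  case (Suc n)
  then obtain c v where w: "w = c # v" and v: "length v = n" by (cases w) auto
  have upt: "map y [i + k..<N] = y (i + k) # map y [i + Suc k..<N]"
    using Suc.prems(4) w by (simp add: upt_conv_Cons)
  have ge: "y k \<le> y (i + k)" using least[of i] Suc.prems(3) unfolding lex_le_def by simp
  consider "c = y i" "shuffle_prefix v (suffix (Suc i) y) (suffix k y)"
    | "c = y k" "shuffle_prefix v (suffix i y) (suffix (Suc k) y)"
    using Suc.prems(5) unfolding w by auto
  then show ?case
  proof cases
    case 1
    have c: "c = y 0" using 1(1) Suc.prems(2) Suc.prems(3)[of 0] by simp
    \<comment> \<open>The common part of the two copies after its first letter, which has just been used.\<close>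
    define p where "p = map y [1..<k]"
    have low: "suffix 1 y = p \<frown> suffix k y"
      using Suc.prems(2) by (auto simp: p_def fun_eq_iff conc_def)
    have "suffix (Suc i) y = p \<frown> suffix (i + k) y"
      using Suc.prems(2) Suc.prems(3) by (auto simp: p_def fun_eq_iff conc_def Suc.prems(3)[symmetric])
    moreover have "lex_le (suffix k y) (suffix (i + k) y)"
      using lex_le_suffix[OF least[of i], of k] Suc.prems(3) by (simp add: add.commute)
    ultimately obtain v' where v': "shuffle_prefix v' (suffix (i + k) y) (suffix 1 y)"
      "length v' = length v" "v \<le> v'"
      using shuffle_exchange[of v p "suffix (i + k) y" "suffix k y"] 1(2) low by auto
    have "y 0 \<le> y (i + k)" using least[of "i + k"] unfolding lex_le_def by auto
    then consider "y 0 < y (i + k)" | "y (i + k) = y 0" by fastforce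
    then show ?thesis
    proof cases
      case 2
      have "v' < map y [i + k + 1..<N]"
        by (rule Suc.hyps(1)) (use v' v Suc.prems 2 w in auto)
      then show ?thesis using v'(3) c 2 unfolding w upt by auto
    qed (simp add: w upt c)
  next
    case 2
    show ?thesis
    proof (cases "y k = y (i + k)")
      case True
      have "v < map y [i + Suc k..<N]"
        by (rule Suc.hyps(1)) (use v Suc.prems 2 w True in \<open>auto simp: less_Suc_eq\<close>)
      then show ?thesis using 2 True unfolding w upt by simp
    next
      case False
      then show ?thesis using 2 ge unfolding w upt by auto
    qed
  qed
qed

lemma shuffle_path_suffix:
  assumes "shuffle_path y u"
  shows "shuffle_prefix (map y [t..<t + n]) (suffix (u t) y) (suffix (t - u t) y)"
proof (induction n arbitrary: t)
  case (Suc n)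
  have le: "u t \<le> t" using shuffle_path_le[OF assms] .
  have upt: "[t..<t + Suc n] = t # [Suc t..<Suc t + n]" by (simp add: upt_conv_Cons del: upt_Suc)
  have tail: "suffix 1 (suffix k y) = suffix (Suc k) y" for k by simp
  have head: "suffix k y 0 = y k" for k by simp
  consider "u (Suc t) = Suc (u t)" "y t = y (u t)" | "u (Suc t) = u t" "y t = y (t - u t)"
    using assms unfolding shuffle_path_def by blast
  then show ?case
  proof cases
    case 1
    then show ?thesis using Suc.IH[of "Suc t"]
      unfolding upt list.map shuffle_prefix.simps tail head by (simp only: diff_Suc_Suc simp_thms)
  next
    case 2
    then show ?thesis using Suc.IH[of "Suc t"]
      unfolding upt list.map shuffle_prefix.simps tail head by (simp only: Suc_diff_le[OF le] simp_thms)
  qed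
qed simp

text \<open>The lemma \<open>shuffle_less_of_least\<close> applies from the first letter of the second copy on, provided that some
  prefix of \<open>y\<close> is long enough and has no border that starts at or after this position \<open>i\<close>. The
  prefix that ends at the first difference between \<open>y\<close> and its suffix at \<open>i\<close> will do.\<close>
lemma infinite_lyndon_not_self_shuffling:
  fixes y :: "'a::linorder word"
  assumes least: "\<And>i. lex_le y (suffix i y)" and nonper: "\<And>i. 0 < i \<Longrightarrow> suffix i y \<noteq> y"
  shows "\<not> self_shuffling y"
proof
  assume "self_shuffling y"
  then obtain u' where "shuffle_path y u'" by (rule self_shuffling_imp_path)
  then obtain u where u: "shuffle_path y u" and u1: "u 1 = 1"
  proof (cases "u' 1 = 1")
    case False
    then have "u' 1 = 0" using \<open>shuffle_path y u'\<close> unfolding shuffle_path_def by (metis One_nat_def)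
    then show ?thesis using that[of "\<lambda>t. t - u' t"] shuffle_path_swap[OF \<open>shuffle_path y u'\<close>] by simp
  qed
  have u0: "u 0 = 0"
    and step: "\<And>t. u (Suc t) = Suc (u t) \<and> y t = y (u t) \<or> u (Suc t) = u t \<and> y t = y (t - u t)"
    and v_unb: "\<And>m. \<exists>t. m \<le> t - u t"
    using u unfolding shuffle_path_def by blast+
  have ex: "\<exists>t. u (Suc t) = u t"
  proof (rule ccontr)
    assume "\<nexists>t. u (Suc t) = u t"
    then have "u (Suc t) = Suc (u t)" for t using step by blast
    then have "u t = t" for t by (induction t) (simp_all add: u0)
    then show False using v_unb[of 1] by simp
  qed
  define i where "i = (LEAST t. u (Suc t) = u t)"
  have ui: "u (Suc i) = u i" unfolding i_def using ex by (rule LeastI_ex)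
  have "t \<le> i \<Longrightarrow> u t = t" for t
  proof (induction t)
    case (Suc t)
    then have "u (Suc t) \<noteq> u t" using not_less_Least[of t "\<lambda>t. u (Suc t) = u t"] by (simp add: i_def)
    then show ?case using step[of t] Suc by simp
  qed (simp add: u0)
  then have i: "u i = i" by simp
  have "0 < i" using ui u0 u1 by (cases i) auto
  have yi: "y i = y 0" using step[of i] ui i by auto
  have "\<exists>k. y (i + k) \<noteq> y k"
    using nonper[OF \<open>0 < i\<close>] by (auto simp: fun_eq_iff)
  define m where "m = (LEAST k. y (i + k) \<noteq> y k)"
  have m: "y (i + m) \<noteq> y m"
    unfolding m_def using \<open>\<exists>k. y (i + k) \<noteq> y k\<close> by (rule LeastI_ex)
  have agree: "y (i + k) = y k" if "k < m" for k
    using not_less_Least[of k "\<lambda>k. y (i + k) \<noteq> y k"] that by (auto simp: m_def)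
  have m_less: "y m < y (i + m)" using m agree least[of i] unfolding lex_le_def by (metis suffix_nth order_less_le)
  define N where "N = Suc (i + m)"
  have unb: "\<exists>k. r + k < N \<and> y (r + k) \<noteq> y k" if "i \<le> r" "r < N" for r
  proof (rule ccontr)
    assume "\<nexists>k. r + k < N \<and> y (r + k) \<noteq> y k"
    then have border: "y (r + k) = y k" if "r + k < N" for k using that by blast
    \<comment> \<open>A border at \<open>r\<close> would turn the last letter \<open>y (i + m)\<close> into \<open>y (m - d)\<close>. But \<open>y\<close> and its suffix
      at \<open>d\<close> agree before that position, so that \<open>y (m - d) \<le> y m < y (i + m)\<close>.\<close>
    define d where "d = r - i"
    have r: "r = i + d" and d: "d \<le> m" using that by (auto simp: d_def N_def)
    have "y (d + k) = y k" if "k < m - d" for k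
      using border[of k] agree[of "d + k"] that unfolding r by (simp add: N_def add.assoc)
    then have "y (m - d) \<le> y m"
      using least[of d] d unfolding lex_le_def by (metis suffix_nth le_add_diff_inverse)
    moreover have "y (i + m) = y (m - d)"
      using border[of "m - d"] d unfolding r N_def by simp
    ultimately show False using m_less by simp
  qed
  have "map y [Suc i..<N] < map y [i + 1..<N]"
  proof (rule shuffle_less_of_least[OF least unb, where i = i and k = 1])
    show "shuffle_prefix (map y [Suc i..<N]) (suffix i y) (suffix 1 y)"
      using shuffle_path_suffix[OF u, of "Suc i" m] ui i by (simp add: N_def)
  qed (use yi in \<open>auto simp: N_def\<close>)
  then show False by simp
qed

section \<open>Limits of shifts\<close>

text \<open>The least word of the shift orbit closure, built letter by letter: \<open>s n\<close> is an occurrence in \<open>x\<close>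
  of its prefix of length \<open>n\<close>, and the next occurrence is chosen among those of this prefix so that
  the letter which follows is as small as possible. Each factor of the limit is a factor of \<open>x\<close> and
  so was a candidate in this choice.\<close>
lemma ex_least_limit:
  fixes x :: "nat word"
  obtains y where "\<And>n. \<exists>s. \<forall>k<n. y k = x (s + k)" "\<And>i. lex_le y (suffix i y)"
proof -
  define good where "good n s s' \<longleftrightarrow> (\<forall>k<n. x (s' + k) = x (s + k)) \<and>
      (\<forall>r. (\<forall>k<n. x (r + k) = x (s + k)) \<longrightarrow> x (s' + n) \<le> x (r + n))" for n s s'
  have good_ex: "\<exists>s'. good n s s'" for n s
    using ex_has_least_nat[of "\<lambda>r. \<forall>k<n. x (r + k) = x (s + k)" s "\<lambda>r. x (r + n)", OF allI[OF impI[OF refl]]]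
    unfolding good_def .
  obtain s where s: "\<And>n. good n (s n) (s (Suc n))"
    using dependent_nat_choice[of "\<lambda>_ _. True" good] good_ex by auto
  have keep: "x (s (Suc n) + k) = x (s n + k)" if "k < n" for n k
    using s[of n] that unfolding good_def by blast
  have min: "x (s (Suc n) + n) \<le> x (r + n)" if "\<And>k. k < n \<Longrightarrow> x (r + k) = x (s n + k)" for n r
    using s[of n] that unfolding good_def by blast
  define y where "y n = x (s (Suc n) + n)" for n
  have y: "k < n \<Longrightarrow> x (s n + k) = y k" for k n
    by (induction n) (auto simp: y_def less_Suc_eq keep)
  show thesis
  proof (rule that)
    show "\<exists>s. \<forall>k<n. y k = x (s + k)" for n using y[of _ n] by metis
    show "lex_le y (suffix i y)" for i
      unfolding lex_le_def
    proof (intro allI impI)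
      fix n assume agree: "\<forall>k<n. y k = suffix i y k"
      have r: "x ((s (Suc (i + n)) + i) + k) = y (i + k)" if "k \<le> n" for k
        using y[of "i + k" "Suc (i + n)"] that by (simp add: add.assoc)
      have "x (s (Suc n) + n) \<le> x ((s (Suc (i + n)) + i) + n)"
        by (rule min) (use agree r y in auto)
      then show "y n \<le> suffix i y n" using r[of n] by (simp add: y_def)
    qed
  qed
qed

text \<open>Long windows of period \<open>P\<close> occur to the right of the position \<open>s0\<close>, where the period fails. Each
  can be extended to the left up to the last failure before it. The resulting factors are
  determined by their length and their first \<open>P + 1\<close> letters, and one choice of these letters
  occurs for arbitrarily long factors because the alphabet is finite.\<close>
lemma ex_broken_period_limit:
  fixes x :: "'a word"
  assumes fin: "finite (range x)" and P: "0 < P"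
    and windows: "\<And>n. \<exists>s. \<forall>t<n. x (s + t + P) = x (s + t)"
    and brk: "x (s0 + P) \<noteq> x s0"
  obtains y where "\<And>n. \<exists>s. \<forall>k<n. y k = x (s + k)"
    "\<And>t. 0 < t \<Longrightarrow> y (t + P) = y t" "y P \<noteq> y 0"
proof -
  have run: "\<exists>s. x (s + P) \<noteq> x s \<and> (\<forall>t. 0 < t \<and> t < n \<longrightarrow> x (s + t + P) = x (s + t))" for n
  proof -
    \<comment> \<open>A window of length \<open>s0 + 1 + n\<close> keeps length \<open>n\<close> when its part up to \<open>s0\<close> is cut off.\<close>
    obtain m where m: "\<forall>t<s0 + 1 + n. x (m + t + P) = x (m + t)" using windows by blast
    have inw: "x (q + P) = x q" if "m \<le> q" "q < m + (s0 + 1 + n)" for q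
      using m[rule_format, of "q - m"] that by simp
    define r where "r = max m (s0 + 1)"
    let ?B = "{s. s < r \<and> x (s + P) \<noteq> x s}"
    define s where "s = Max ?B"
    have "finite ?B" "?B \<noteq> {}" using brk by (auto simp: r_def intro!: exI[of _ s0])
    then have "s \<in> ?B" and max: "\<And>q. q \<in> ?B \<Longrightarrow> q \<le> s" unfolding s_def by (rule Max_in, auto)
    moreover have "x (s + t + P) = x (s + t)" if "0 < t" "t < n" for t
    proof (cases "s + t < r")
      case True then show ?thesis using max[of "s + t"] that by auto
    next
      case False
      then show ?thesis using inw[of "s + t"] that \<open>s \<in> ?B\<close> by (auto simp: r_def)
    qed
    ultimately show ?thesis by blast
  qed
  define S where "S n = (SOME s. x (s + P) \<noteq> x s \<and> (\<forall>t. 0 < t \<and> t < n \<longrightarrow> x (s + t + P) = x (s + t)))" for n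
  have S: "x (S n + P) \<noteq> x (S n)" "0 < t \<Longrightarrow> t < n \<Longrightarrow> x (S n + t + P) = x (S n + t)" for n t
    using someI_ex[OF run[of n]] unfolding S_def by blast+
  define f where "f n = map (\<lambda>k. x (S n + k)) [0..<Suc P]" for n
  have "range f \<subseteq> {w. set w \<subseteq> range x \<and> length w = Suc P}" by (auto simp: f_def)
  then have "finite (range f)" using finite_lists_length_eq[OF fin] finite_subset by blast
  then obtain v where inf: "infinite {n. f n = f v}"
    using pigeonhole_infinite[of UNIV f] by auto
  define y where "y k = (if k = 0 then f v ! 0 else f v ! (Suc ((k - 1) mod P)))" for k
  have lim: "\<exists>s. \<forall>k<n. y k = x (s + k)" for n
  proof -
    obtain M where M: "n < M" "f M = f v" using inf by (auto simp: infinite_nat_iff_unbounded)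
    have nth: "f v ! k = x (S M + k)" if "k \<le> P" for k
      using that unfolding M(2)[symmetric] by (auto simp: f_def simp del: upt_Suc)
    have "y k = x (S M + k)" if "k < n" for k
      using that
    proof (induction k rule: less_induct)
      case (less k)
      show ?case
      proof (cases "k \<le> P")
        case True
        then show ?thesis using P by (cases k) (auto simp: y_def nth)
      next
        case False
        then have "(k - 1) mod P = (k - P - 1) mod P" by (simp add: le_mod_geq)
        then have "y k = y (k - P)" using False by (simp add: y_def)
        also have "\<dots> = x (S M + (k - P))" using less False P by simp
        also have "\<dots> = x (S M + k)" using S(2)[of "k - P" M] False less.prems M(1) by simp
        finally show ?thesis .
      qed
    qed
    then show ?thesis by blast
  qed
  show thesis
  proof (rule that[OF lim])
    show "y (t + P) = y t" if "0 < t" for t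
      using that by (cases t) (simp_all add: y_def)
    show "y P \<noteq> y 0"
      using S(1)[of v] P by (cases P) (auto simp: y_def f_def nth_append simp del: upt_Suc)
  qed
qed

section \<open>A point that is not self-shuffling\<close>

theorem corollary4p9:
  fixes A :: "'a set" and x :: "'a word"
  assumes "finite A" and "A \<noteq> {}"
    and "range x \<subseteq> A"
    and "aperiodic x"
  shows "\<exists>y \<in> shift_orbit_closure x. \<not> self_shuffling y"
proof (cases "\<exists>P>0. \<forall>n. \<exists>s. \<forall>t<n. x (s + t + P) = x (s + t)")
  case True
  then obtain P where P: "0 < P" and windows: "\<And>n. \<exists>s. \<forall>t<n. x (s + t + P) = x (s + t)" by blast
  have "\<exists>s. x (s + P) \<noteq> x s"
  proof (rule ccontr)
    assume "\<nexists>s. x (s + P) \<noteq> x s"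
    then have per: "x (s + P) = x s" for s by blast
    have "x n = x (n mod P)" for n
    proof (induction n rule: less_induct)
      case (less n)
      then show ?case using per[of "n - P"] P by (cases "n < P") (simp_all add: le_mod_geq)
    qed
    then have "x = [] \<frown> (prefix P x)\<^sup>\<omega>" using P by (auto simp: fun_eq_iff iter_def)
    moreover have "prefix P x \<noteq> []" using P by simp
    ultimately show False using assms(4) unfolding aperiodic_def ultimately_periodic_def by blast
  qed
  then obtain s0 where "x (s0 + P) \<noteq> x s0" by blast
  moreover have "finite (range x)" using assms(1,3) finite_subset by blast
  ultimately obtain y where lim: "\<And>n. \<exists>s. \<forall>k<n. y k = x (s + k)"
    and y: "\<And>t. 0 < t \<Longrightarrow> y (t + P) = y t" "y P \<noteq> y 0"
    using ex_broken_period_limit[OF _ P windows] by metis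
  show ?thesis
    using shift_orbit_closureI[OF lim] broken_period_not_self_shuffling[OF P y] by blast
next
  case False
  obtain e :: "'a \<Rightarrow> nat" where e: "inj_on e A" using finite_imp_inj_to_nat_seg[OF assms(1)] by blast
  obtain z where z: "\<And>n. \<exists>s. \<forall>k<n. z k = (e \<circ> x) (s + k)" and least: "\<And>i. lex_le z (suffix i z)"
    using ex_least_limit by blast
  define y where "y = inv_into A e \<circ> z"
  have y: "\<exists>s. \<forall>k<n. y k = x (s + k) \<and> z k = e (y k)" for n
  proof -
    obtain s where "\<forall>k<n. z k = e (x (s + k))" using z[of n] by auto
    moreover have "inv_into A e (e (x q)) = x q" for q using e assms(3) by (intro inv_into_f_f) auto
    ultimately show ?thesis unfolding y_def by (intro exI[of _ s]) simp
  qed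
  have zy: "z = e \<circ> y"
  proof
    show "z k = (e \<circ> y) k" for k using y[of "Suc k"] by auto
  qed
  have "suffix i z \<noteq> z" if "0 < i" for i
  proof
    assume per: "suffix i z = z"
    have zi: "z (t + i) = z t" for t using fun_cong[OF per, of t] by (simp add: add.commute)
    have "\<exists>s. \<forall>t<n. x (s + t + i) = x (s + t)" for n
    proof -
      obtain s where s: "\<forall>k<n + i. y k = x (s + k)" using y[of "n + i"] by blast
      have "y (t + i) = y t" for t unfolding y_def by (simp add: zi)
      then show ?thesis using s by (intro exI[of _ s]) (metis add.assoc add_less_cancel_right trans_less_add1)
    qed
    then show False using False that by blast
  qed
  then have "\<not> self_shuffling z" using infinite_lyndon_not_self_shuffling[OF least] by blast
  then have "\<not> self_shuffling y" using self_shuffling_comp[of y e] zy by blast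
  moreover have "y \<in> shift_orbit_closure x" by (rule shift_orbit_closureI) (use y in blast)
  ultimately show ?thesis by blast
qed

end
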